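(* Every unidirectional linear systolic algorithm with $n$ cells whose inputs and results both stream (a moving-results design) embeds on a chain of $n$ rings of a cyclic-storage machine, one operation station and one transfer station each, with window $W=O(1)$ on every ring and constant slowdown: a cell is a station, a beat is a constant-size block of slots carrying its instruction alongside its operands, a stationary cell constant is a station constant, and a delay between streams is the phase offset of a scheduled transfer. A one-cell design embeds on a single ring.
   Context: Unidirectional linear systolic algorithm with $n$ cells and moving inputs and results: a schedule of beats in which, at beat $k$, cell $c$ reads a bounded number $r$ of values of its input streams, at beat offsets in a fixed set $\{0,\dots,\rho\}$ behind the current beat, reads at most one cell constant (a stationary weight), and writes one value of its output stream, which cell $c+1$ reads $\delta_c$ beats later, a constant delay; a cell may also forward streams; streams flow from cell $c$ to cell $c+1$ only. The $O(1)$ and "constant" are with respect to $n$ and the number of beats (they may depend on $r$, $\rho$, and the number of streams). Cyclic-storage machine with window $W$: packets (values, instructions, or empty) are stored in rings, cyclic arrays of slots advancing one position per cycle, all rings in lockstep; stations are at fixed positions; an instruction packet arriving at an operation station reads operands at most $W$ slots ahead of itself (and possibly a constant held at the station) and rewrites a packet at most $W$ slots ahead; a transfer instruction arriving at a transfer station copies a packet within the window into the next ring at a scheduled phase (landing position). Slowdown is the number of cycles per beat. Embedding means that the rings compute the same output streams as the systolic algorithm. *)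

theory Defs
  imports Main
begin

section \<open>Unidirectional linear systolic algorithms\<close>

text \<open>
  Where a stream entering cell \<open>c + 1\<close> originates: it is the output stream of cell \<open>c\<close>, or one of
  the streams entering cell \<open>c\<close>, forwarded. Nothing else can feed a cell, so the flow is
  unidirectional; only the streams entering cell \<open>0\<close> come from outside.
\<close>

datatype source = Result | Forward nat

text \<open>
  The algorithm is pure structure: operations are named by opcodes of type \<open>'op\<close>, and their meaning,
  the cell constants and all stream data are supplied separately. Cells, beats and streams are
  numbered from \<open>0\<close>. In \<open>reads A c k\<close> a pair \<open>(j, o)\<close> is a read of stream \<open>j\<close> at beat \<open>k - o\<close>.
  \<open>source A c j\<close> and \<open>fwd_delay A c j\<close> concern stream \<open>j\<close> of cell \<open>c + 1\<close>.
\<close>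

record 'op systolic =
  cells     :: nat
  beats     :: nat
  streams   :: nat
  opcode    :: "nat \<Rightarrow> nat \<Rightarrow> 'op"
  reads     :: "nat \<Rightarrow> nat \<Rightarrow> (nat \<times> nat) list"
  source    :: "nat \<Rightarrow> nat \<Rightarrow> source"
  out_delay :: "nat \<Rightarrow> nat"
  fwd_delay :: "nat \<Rightarrow> nat \<Rightarrow> nat"

definition systolic_wf :: "nat \<Rightarrow> nat \<Rightarrow> 'op systolic \<Rightarrow> bool" where
  "systolic_wf r \<rho> A \<longleftrightarrow>
     0 < cells A \<and>
     (\<forall>c < cells A. \<forall>k < beats A.
        length (reads A c k) \<le> r \<and> (\<forall>(j, o') \<in> set (reads A c k). j < streams A \<and> o' \<le> \<rho>)) \<and>
     (\<forall>c j i. Suc c < cells A \<longrightarrow> j < streams A \<longrightarrow> source A c j = Forward i \<longrightarrow> i < streams A)"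

definition delay :: "'op systolic \<Rightarrow> nat \<Rightarrow> nat \<Rightarrow> nat" where
  "delay A c j = (case source A c j of Result \<Rightarrow> out_delay A c | Forward _ \<Rightarrow> fwd_delay A c j)"

text \<open>
  Data: \<open>f\<close> interprets opcodes as functions of the optional cell constant and the operands, \<open>w c\<close> is
  the constant of cell \<open>c\<close>. \<open>x c j k\<close> is the boundary data: for \<open>c = 0\<close> the external input streams,
  and for \<open>c > 0\<close> the initial contents of stream \<open>j\<close>, that is its values at those beats \<open>k\<close> (possibly
  negative) which nothing sent by cell \<open>c - 1\<close> from beat \<open>0\<close> on has reached.
\<close>

definition apply_cell ::
  "'op systolic \<Rightarrow> ('op \<Rightarrow> 'v option \<Rightarrow> 'v list \<Rightarrow> 'v) \<Rightarrow> (nat \<Rightarrow> 'v option) \<Rightarrow>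
   nat \<Rightarrow> (nat \<Rightarrow> int \<Rightarrow> 'v) \<Rightarrow> nat \<Rightarrow> 'v" where
  "apply_cell A f w c ins k =
     f (opcode A c k) (w c) (map (\<lambda>(j, o'). ins j (int k - int o')) (reads A c k))"

primrec stream ::
  "'op systolic \<Rightarrow> ('op \<Rightarrow> 'v option \<Rightarrow> 'v list \<Rightarrow> 'v) \<Rightarrow> (nat \<Rightarrow> 'v option) \<Rightarrow>
   (nat \<Rightarrow> nat \<Rightarrow> int \<Rightarrow> 'v) \<Rightarrow> nat \<Rightarrow> nat \<Rightarrow> int \<Rightarrow> 'v" where
  "stream A f w x 0 = x 0"
| "stream A f w x (Suc c) = (\<lambda>j k.
     if k < int (delay A c j) then x (Suc c) j k
     else case source A c j of
       Result \<Rightarrow> apply_cell A f w c (stream A f w x c) (nat (k - int (delay A c j)))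
     | Forward i \<Rightarrow> stream A f w x c i (k - int (delay A c j)))"

definition cell_output ::
  "'op systolic \<Rightarrow> ('op \<Rightarrow> 'v option \<Rightarrow> 'v list \<Rightarrow> 'v) \<Rightarrow> (nat \<Rightarrow> 'v option) \<Rightarrow>
   (nat \<Rightarrow> nat \<Rightarrow> int \<Rightarrow> 'v) \<Rightarrow> nat \<Rightarrow> nat \<Rightarrow> 'v" where
  "cell_output A f w x c k = apply_cell A f w c (stream A f w x c) k"

section \<open>Cyclic-storage machines\<close>

text \<open>
  \<open>Op h ds e\<close> applies \<open>h\<close> to the packets \<open>ds\<close> slots ahead of itself and rewrites the packet \<open>e\<close> slots
  ahead. \<open>Transfer d p\<close> copies the packet \<open>d\<close> slots ahead into whichever slot of the next ring is at
  landing position \<open>p\<close> in that cycle.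
\<close>

datatype ('op, 'v) packet =
  Empty
| is_Val: Val (val_of: 'v)
| Op 'op "nat list" nat
| Transfer nat nat

text \<open>
  A machine holds no data: \<open>Val (j, k)\<close> in the initial load of ring \<open>c\<close> is a placeholder for the
  boundary datum \<open>x c j k\<close>. Station constants are supplied with the data too.
\<close>

record 'op machine =
  rings  :: nat
  len    :: "nat \<Rightarrow> nat"
  op_pos :: "nat \<Rightarrow> nat"
  tr_pos :: "nat \<Rightarrow> nat"
  load   :: "nat \<Rightarrow> nat \<Rightarrow> ('op, nat \<times> int) packet"

text \<open>
  Slots are numbered in order of arrival: in cycle \<open>t\<close> slot \<open>i\<close> of a ring of length \<open>L\<close> is at position
  \<open>(t - i) mod L\<close>. Hence slot \<open>i - d\<close> is the slot \<open>d\<close> ahead of slot \<open>i\<close>; it passes any given position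
  \<open>d\<close> cycles earlier.
\<close>

definition slot_at :: "nat \<Rightarrow> nat \<Rightarrow> nat \<Rightarrow> nat" where
  "slot_at L t p = nat ((int t - int p) mod int L)"

definition ahead :: "nat \<Rightarrow> nat \<Rightarrow> nat \<Rightarrow> nat" where
  "ahead L i d = nat ((int i - int d) mod int L)"

definition machine_wf :: "nat \<Rightarrow> 'op machine \<Rightarrow> bool" where
  "machine_wf W M \<longleftrightarrow>
     (\<forall>c < rings M. W < len M c \<and> op_pos M c < len M c \<and> tr_pos M c < len M c \<and>
        (\<forall>i < len M c. case load M c i of
            Op h ds e \<Rightarrow> (\<forall>d \<in> set ds. d \<le> W) \<and> e \<le> W
          | Transfer d p \<Rightarrow> d \<le> W \<and> Suc c < rings M \<and> p < len M (Suc c)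
          | _ \<Rightarrow> True))"

type_synonym ('op, 'v) state = "nat \<Rightarrow> nat \<Rightarrow> ('op, 'v) packet"

definition operate ::
  "('op \<Rightarrow> 'v option \<Rightarrow> 'v list \<Rightarrow> 'v) \<Rightarrow> 'v option \<Rightarrow> 'op \<Rightarrow> ('op, 'v) packet list \<Rightarrow> ('op, 'v) packet"
where
  "operate f kc h ps = (if \<forall>p \<in> set ps. is_Val p then Val (f h kc (map val_of ps)) else Empty)"

text \<open>
  The writes of a cycle, as (slot, new packet): by the operation station of ring \<open>c\<close>, and by the
  transfer station of ring \<open>c\<close> into ring \<open>c + 1\<close>.
\<close>

definition op_write ::
  "'op machine \<Rightarrow> ('op \<Rightarrow> 'v option \<Rightarrow> 'v list \<Rightarrow> 'v) \<Rightarrow> (nat \<Rightarrow> 'v option) \<Rightarrow> nat \<Rightarrow>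
   ('op, 'v) state \<Rightarrow> nat \<Rightarrow> (nat \<times> ('op, 'v) packet) option" where
  "op_write M f w t \<sigma> c =
     (let L = len M c; i = slot_at L t (op_pos M c) in
      case \<sigma> c i of
        Op h ds e \<Rightarrow> Some (ahead L i e, operate f (w c) h (map (\<lambda>d. \<sigma> c (ahead L i d)) ds))
      | _ \<Rightarrow> None)"

definition tr_write ::
  "'op machine \<Rightarrow> nat \<Rightarrow> ('op, 'v) state \<Rightarrow> nat \<Rightarrow> (nat \<times> ('op, 'v) packet) option" where
  "tr_write M t \<sigma> c =
     (let L = len M c; i = slot_at L t (tr_pos M c) in
      case \<sigma> c i of
        Transfer d p \<Rightarrow> Some (slot_at (len M (Suc c)) t p, \<sigma> c (ahead L i d))
      | _ \<Rightarrow> None)"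

text \<open>
  All stations act simultaneously on the state at the start of the cycle. Should both writes into a
  ring hit the same slot, the landing packet wins.
\<close>

definition step ::
  "'op machine \<Rightarrow> ('op \<Rightarrow> 'v option \<Rightarrow> 'v list \<Rightarrow> 'v) \<Rightarrow> (nat \<Rightarrow> 'v option) \<Rightarrow> nat \<Rightarrow>
   ('op, 'v) state \<Rightarrow> ('op, 'v) state" where
  "step M f w t \<sigma> = (\<lambda>c.
     let stay  = \<sigma> c;
         acted = (case op_write M f w t \<sigma> c of None \<Rightarrow> stay | Some (i, p) \<Rightarrow> stay(i := p))
     in case c of
          0 \<Rightarrow> acted
        | Suc b \<Rightarrow> (case tr_write M t \<sigma> b of None \<Rightarrow> acted | Some (i, p) \<Rightarrow> acted(i := p)))"

text \<open>\<open>run M f w x t\<close> is the state at the start of cycle \<open>t\<close>.\<close>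

primrec run ::
  "'op machine \<Rightarrow> ('op \<Rightarrow> 'v option \<Rightarrow> 'v list \<Rightarrow> 'v) \<Rightarrow> (nat \<Rightarrow> 'v option) \<Rightarrow>
   (nat \<Rightarrow> nat \<Rightarrow> int \<Rightarrow> 'v) \<Rightarrow> nat \<Rightarrow> ('op, 'v) state" where
  "run M f w x 0 = (\<lambda>c i. map_packet id (\<lambda>(j, k). x c j k) (load M c i))"
| "run M f w x (Suc t) = step M f w t (run M f w x t)"

section \<open>Embeddings\<close>

text \<open>
  With slowdown \<open>S\<close>, beat \<open>k\<close> of cell \<open>c\<close> is the block of \<open>S\<close> consecutive slots of ring \<open>c\<close> starting at
  \<open>base Y c + S * k\<close> (cyclically). The other fields but \<open>landing\<close> are places within a block, the same
  in every block: of the instruction, of the result, of the value of stream \<open>j\<close>, and of the transfer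
  instruction sending stream \<open>j\<close> on to the next ring. \<open>landing Y c j\<close> is the landing position of
  stream \<open>j\<close> of ring \<open>c + 1\<close>; it does not depend on the beat.
\<close>

record layout =
  base       :: "nat \<Rightarrow> nat"
  op_place   :: nat
  res_place  :: nat
  str_place  :: "nat \<Rightarrow> nat"
  tr_place   :: "nat \<Rightarrow> nat"
  landing    :: "nat \<Rightarrow> nat \<Rightarrow> nat"

definition block_slot :: "nat \<Rightarrow> 'op machine \<Rightarrow> layout \<Rightarrow> nat \<Rightarrow> int \<Rightarrow> nat \<Rightarrow> nat" where
  "block_slot S M Y c k v = nat ((int (base Y c) + int S * k + int v) mod int (len M c))"

text \<open>
  Beat \<open>k\<close> of cell \<open>c\<close> takes place in the \<open>S\<close> cycles from \<open>S * (k + lag A c)\<close> on. If all delays are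
  positive then \<open>lag A c = 0\<close>. A link with delay \<open>0\<close> lets a cell use a value in the very beat in which
  its predecessor produces it, so there the beats of the later cells are shifted by one.
\<close>

definition lag :: "'op systolic \<Rightarrow> nat \<Rightarrow> nat" where
  "lag A c = card {i. i < c \<and> (\<exists>j < streams A. delay A i j = 0)}"

definition embedding ::
  "nat \<Rightarrow> nat \<Rightarrow> nat \<Rightarrow> 'op systolic \<Rightarrow> 'op machine \<Rightarrow> layout \<Rightarrow> bool" where
  "embedding W S \<rho> A M Y \<longleftrightarrow>
     machine_wf W M \<and> rings M = cells A \<and>
     (let places = op_place Y # res_place Y #
                     map (str_place Y) [0..<streams A] @ map (tr_place Y) [0..<streams A]
      in distinct places \<and> (\<forall>v \<in> set places. v < S)) \<and>
     (\<forall>c < cells A. S * (\<rho> + beats A) \<le> len M c) \<and>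
     (\<forall>c < cells A. \<forall>k < beats A.
        let L = len M c; i = block_slot S M Y c (int k) (op_place Y) in
        (\<exists>ds e. load M c i = Op (opcode A c k) ds e \<and>
           map (ahead L i) ds =
             map (\<lambda>(j, o'). block_slot S M Y c (int k - int o') (str_place Y j)) (reads A c k) \<and>
           ahead L i e = block_slot S M Y c (int k) (res_place Y)) \<and>
        slot_at L (S * (k + lag A c) + op_place Y) (op_pos M c) = i) \<and>
     (\<forall>c j k. Suc c < cells A \<longrightarrow> j < streams A \<longrightarrow> k < beats A \<longrightarrow>
        (let L = len M c; i = block_slot S M Y c (int k) (tr_place Y j) in
         (\<exists>d. load M c i = Transfer d (landing Y c j) \<and>
            ahead L i d = block_slot S M Y c (int k)
              (case source A c j of Result \<Rightarrow> res_place Y | Forward i' \<Rightarrow> str_place Y i')) \<and>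
         (\<exists>t. S * (k + lag A c) \<le> t \<and> t < S * (k + lag A c + 1) \<and>
            slot_at L t (tr_pos M c) = i \<and>
            slot_at (len M (Suc c)) t (landing Y c j) =
              block_slot S M Y (Suc c) (int k + int (delay A c j)) (str_place Y j))))"

text \<open>
  When the instruction of a beat reaches the operation station, the stream values of that beat and of
  the \<open>\<rho>\<close> beats before it are in their slots. By the end of the beat the result is in its slot, where
  it stays until the last beat of the last cell is over.
\<close>

definition computes ::
  "nat \<Rightarrow> nat \<Rightarrow> 'op systolic \<Rightarrow> 'op machine \<Rightarrow> layout \<Rightarrow>
   ('op \<Rightarrow> 'v option \<Rightarrow> 'v list \<Rightarrow> 'v) \<Rightarrow> (nat \<Rightarrow> 'v option) \<Rightarrow> (nat \<Rightarrow> nat \<Rightarrow> int \<Rightarrow> 'v) \<Rightarrow> bool" where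
  "computes S \<rho> A M Y f w x \<longleftrightarrow>
     (\<forall>c < cells A. \<forall>k < beats A.
        (\<forall>j < streams A. \<forall>o' \<le> \<rho>.
           run M f w x (S * (k + lag A c) + op_place Y) c
             (block_slot S M Y c (int k - int o') (str_place Y j)) =
           Val (stream A f w x c j (int k - int o'))) \<and>
        (\<forall>t. S * (k + lag A c + 1) \<le> t \<longrightarrow> t \<le> S * (beats A + lag A (cells A - 1)) \<longrightarrow>
           run M f w x t c (block_slot S M Y c (int k) (res_place Y)) =
           Val (cell_output A f w x c k)))"

definition no_transfers :: "'op machine \<Rightarrow> bool" where
  "no_transfers M \<longleftrightarrow> (\<forall>c < rings M. \<forall>i < len M c. \<forall>d p. load M c i \<noteq> Transfer d p)"

end

theory Submission
  imports Defs
begin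

text \<open>
  All rings get the same length \<open>S * N\<close>, with \<open>S = 2 s + 2\<close> slots per block for \<open>s\<close> streams and so many
  blocks that nothing wraps around during the computation; all stations are at position \<open>0\<close>, so cycle
  \<open>t\<close> processes slot \<open>t mod (S * N)\<close>. A block holds, in order of arrival, the stream values, the result,
  the instruction and the transfers. So an instruction finds its operands ahead of it, and the transfers
  of a beat fire after its operation. A value sent over a link is in place before the receiving cell's
  instruction fires: if the delay is positive, that happens in a later block, and if it is \<open>0\<close>, \<open>lag\<close>
  shifts the receiving cell by one block. Operations write only result slots and transfers write only
  stream slots, so the instructions stay intact.
\<close>

section \<open>Construction of the machine and its layout\<close>

locale ring_embedding =
  fixes A :: "'op systolic" and r \<rho> :: nat
  assumes wf: "systolic_wf r \<rho> A"
begin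

definition S :: nat where "S = 2 * streams A + 2"

definition total_delay :: nat where
  "total_delay = (\<Sum>c<cells A. \<Sum>j<streams A. delay A c j)"

text \<open>Room for \<open>\<rho>\<close> negative beats, all beats, the shift by
  \<open>lag\<close>, and values that land beyond the last beat, at most \<open>total_delay\<close>
  blocks further. The summand \<open>2\<close> keeps the window \<open>S * (\<rho> + 1)\<close>
  shorter than the ring.\<close>

definition N :: nat where
  "N = \<rho> + beats A + cells A + total_delay + 2"

definition L :: nat where "L = S * N"

text \<open>This is \<open>block_slot\<close> for the layout \<open>Y\<close> below. Shifting the
  blocks of ring \<open>c\<close> by \<open>lag A c\<close> makes the slot number of an instruction
  its firing time modulo \<open>L\<close>, as the stations are at position \<open>0\<close>.\<close>

definition slot :: "nat \<Rightarrow> int \<Rightarrow> nat \<Rightarrow> nat" where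
  "slot c k v = nat ((int S * (k + int (lag A c)) + int v) mod int L)"

definition src_place :: "nat \<Rightarrow> nat \<Rightarrow> nat" where
  "src_place c j = (case source A c j of Result \<Rightarrow> streams A | Forward i \<Rightarrow> i)"

text \<open>The landing position is firing time minus target slot, modulo \<open>L\<close>. In
  \<open>S * (k + lag A c) + streams A + 2 + j - (S * (k + delay A c j + lag A (Suc c)) + j)\<close>
  the beat \<open>k\<close> and the place \<open>j\<close> cancel, so one position serves all
  beats.\<close>

definition land :: "nat \<Rightarrow> nat \<Rightarrow> nat" where
  "land c j = nat ((int S * (int (lag A c) - int (lag A (Suc c)) - int (delay A c j))
     + int (streams A) + 2) mod int L)"

text \<open>An operand lies \<open>o'\<close> blocks ahead, at place \<open>j\<close> rather than
  \<open>streams A + 1\<close>. Every read has \<open>j < streams A\<close>, so the subtraction on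
  naturals is exact.\<close>

definition operands :: "nat \<Rightarrow> nat \<Rightarrow> nat list" where
  "operands c k = map (\<lambda>(j, o'). S * o' + streams A + 1 - j) (reads A c k)"

text \<open>The last \<open>\<rho>\<close> blocks of a ring, from \<open>N - \<rho>\<close> on, stand for the negative blocks \<open>-\<rho>, \<dots>, -1\<close>.\<close>

definition init_load :: "nat \<Rightarrow> nat \<Rightarrow> ('op, nat \<times> int) packet" where
  "init_load c i = (let v = i mod S; b = i div S; k = b - lag A c in
     if v < streams A then Val (v, (if b < N - \<rho> then int b else int b - int N) - int (lag A c))
     else if v = streams A \<or> b < lag A c \<or> beats A \<le> k then Empty
     else if v = streams A + 1 then Op (opcode A c k) (operands c k) 1
     else if Suc c < cells A
       then Transfer (v - src_place c (v - (streams A + 2))) (land c (v - (streams A + 2)))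
     else Empty)"

definition M :: "'op machine" where
  "M = \<lparr>rings = cells A, len = \<lambda>_. L, op_pos = \<lambda>_. 0, tr_pos = \<lambda>_. 0, load = init_load\<rparr>"

definition Y :: layout where
  "Y = \<lparr>base = \<lambda>c. S * lag A c, op_place = streams A + 1, res_place = streams A,
     str_place = \<lambda>j. j, tr_place = \<lambda>j. streams A + 2 + j, landing = land\<rparr>"

lemma M_simps [simp]:
  "rings M = cells A" "len M c = L" "op_pos M c = 0" "tr_pos M c = 0" "load M = init_load"
  by (simp_all add: M_def)

lemma Y_simps [simp]:
  "base Y c = S * lag A c" "op_place Y = streams A + 1" "res_place Y = streams A"
  "str_place Y j = j" "tr_place Y j = streams A + 2 + j" "landing Y = land"
  by (simp_all add: Y_def)

lemma S_pos: "0 < S" and N_pos: "0 < N" and L_pos: "0 < L"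
  by (simp_all add: S_def N_def L_def)

lemma block_slot_eq [simp]: "block_slot S M Y c k v = slot c k v"
  by (simp add: block_slot_def slot_def algebra_simps)

section \<open>Bounds on reads, lags and delays\<close>

lemma reads_bound:
  assumes "c < cells A" "k < beats A" "(j, o') \<in> set (reads A c k)"
  shows "j < streams A" "o' \<le> \<rho>"
  using wf assms unfolding systolic_wf_def by fastforce+

lemma src_place_le: "Suc c < cells A \<Longrightarrow> j < streams A \<Longrightarrow> src_place c j \<le> streams A"
  using wf unfolding systolic_wf_def src_place_def
  by (auto split: source.split intro: less_imp_le)

lemma lag_le: "lag A c \<le> c"
proof -
  have "card {i. i < c \<and> (\<exists>j<streams A. delay A i j = 0)} \<le> card {..<c}"
    by (rule card_mono) auto
  thus ?thesis by (simp add: lag_def)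
qed

lemma lag_mono: "c \<le> c' \<Longrightarrow> lag A c \<le> lag A c'"
  unfolding lag_def by (rule card_mono) auto

text \<open>Either the delay is positive, or the link has delay \<open>0\<close> and
  \<open>lag\<close> grows by one. So a value always lands in a block strictly later than the one it
  is sent from.\<close>

lemma lag_Suc:
  assumes "j < streams A"
  shows "lag A c < delay A c j + lag A (Suc c)"
proof (cases "delay A c j = 0")
  case True
  have "{i. i < Suc c \<and> (\<exists>j<streams A. delay A i j = 0)}
      = insert c {i. i < c \<and> (\<exists>j<streams A. delay A i j = 0)}"
    using True assms by (auto simp: less_Suc_eq)
  thus ?thesis by (simp add: lag_def)
next
  case False
  thus ?thesis using lag_mono[of c "Suc c"] by simp
qed

lemma delay_le:
  assumes "c < cells A" "j < streams A"
  shows "delay A c j \<le> total_delay"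
proof -
  have "delay A c j \<le> (\<Sum>j<streams A. delay A c j)"
    using assms by (intro member_le_sum) auto
  also have "\<dots> \<le> (\<Sum>c<cells A. \<Sum>j<streams A. delay A c j)"
    using assms by (intro member_le_sum[where f = "\<lambda>c. \<Sum>j<streams A. delay A c j"]) auto
  finally show ?thesis by (simp add: total_delay_def)
qed

lemma lag_bound: "c < cells A \<Longrightarrow> lag A c < cells A"
  using lag_le[of c] by simp

section \<open>Arithmetic of slots\<close>

lemma slot_less: "slot c k v < L"
  using L_pos by (simp add: slot_def nat_less_iff)

lemma place_div_mod:
  assumes "v < S"
  shows "(S * q + v) div S = q" "(S * q + v) mod S = v"
  using assms by simp_all

lemma slot_nat:
  assumes "k + lag A c < N" "v < S"
  shows "slot c (int k) v = S * (k + lag A c) + v"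
proof -
  have "S * (k + lag A c) + v < S * Suc (k + lag A c)" using assms by simp
  also have "\<dots> \<le> L" unfolding L_def using assms by (intro mult_le_mono) auto
  finally have "(int (S * (k + lag A c) + v)) mod int L = int (S * (k + lag A c) + v)"
    by (metis mod_less zmod_int)
  moreover have "int S * (int k + int (lag A c)) + int v = int (S * (k + lag A c) + v)"
    by simp
  ultimately show ?thesis unfolding slot_def by (metis nat_int)
qed

text \<open>Since \<open>S\<close> divides \<open>L\<close>, wrapping around the ring keeps the
  place within a block and reduces only the block number, modulo \<open>N\<close>.\<close>

lemma slot_div_mod:
  assumes "v < S"
  shows "slot c k v div S = nat ((k + int (lag A c)) mod int N)" "slot c k v mod S = v"
proof -
  have "(int S * (k + int (lag A c)) + int v) mod int L
      = int S * ((k + int (lag A c)) mod int N) + int v"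
    using assms S_pos unfolding L_def of_nat_mult
    by (subst zmod_zmult2_eq) auto
  hence "slot c k v = S * nat ((k + int (lag A c)) mod int N) + v"
    using N_pos by (simp add: slot_def nat_add_distrib nat_mult_distrib)
  thus "slot c k v div S = nat ((k + int (lag A c)) mod int N)" "slot c k v mod S = v"
    using assms by simp_all
qed

text \<open>At most \<open>N\<close> consecutive beats, whose blocks are therefore distinct. The
  upper end leaves the last \<open>\<rho>\<close> blocks of the ring to the negative block
  numbers.\<close>

definition in_range :: "nat \<Rightarrow> int \<Rightarrow> bool" where
  "in_range c k \<longleftrightarrow> - int \<rho> \<le> k \<and> k + int (lag A c) < int (N - \<rho>)"

lemma slot_inj:
  assumes "slot c k v = slot c k' v'" "v < S" "v' < S" "in_range c k" "in_range c k'"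
  shows "k = k'" "v = v'"
proof -
  show "v = v'" using assms slot_div_mod(2) by metis
  have "(k + int (lag A c)) mod int N = (k' + int (lag A c)) mod int N"
    using assms(1-3) slot_div_mod(1) N_pos
    by (metis eq_nat_nat_iff pos_mod_sign of_nat_0_less_iff)
  hence "int N dvd (k - k')"
    by (metis add_diff_cancel_right mod_eq_dvd_iff)
  moreover have "\<bar>k - k'\<bar> < int N"
    using assms(4,5) unfolding in_range_def N_def by auto
  ultimately show "k = k'" using dvd_imp_le_int[of "k - k'" "int N"] by fastforce
qed

lemma in_range_beat:
  assumes "c < cells A" "- int \<rho> \<le> k" "k < int (beats A)"
  shows "in_range c k"
  using assms lag_bound[of c] by (auto simp: in_range_def N_def)

lemma in_range_target:
  assumes "Suc c < cells A" "j < streams A" "k < beats A"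
  shows "in_range (Suc c) (int k + int (delay A c j))"
  using assms lag_bound[of "Suc c"] delay_le[of c j] by (auto simp: in_range_def N_def)

lemma beat_less_N:
  assumes "c < cells A" "k < beats A"
  shows "k + lag A c < N"
  using assms lag_bound[of c] by (auto simp: N_def)

text \<open>The hypothesis compares positions before reduction modulo \<open>L\<close>; the shift by
  \<open>lag\<close> is common to both sides, as both slots are on ring \<open>c\<close>.\<close>

lemma ahead_slot:
  assumes "int S * k + int v - int d = int S * k' + int v'"
  shows "ahead L (slot c k v) d = slot c k' v'"
proof -
  have "(int (slot c k v) - int d) mod int L
      = (int S * (k + int (lag A c)) + int v - int d) mod int L"
    using L_pos unfolding slot_def by (simp add: mod_diff_left_eq)
  also have "\<dots> = (int S * (k' + int (lag A c)) + int v') mod int L"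
    using assms by (intro arg_cong[where f = "\<lambda>x. x mod int L"]) (simp add: algebra_simps)
  finally show ?thesis by (simp add: ahead_def slot_def)
qed

lemma slot_at_0: "slot_at L t 0 = t mod L"
  by (simp add: slot_at_def flip: zmod_int)

lemma slot_at_land:
  assumes "t mod L = slot c (int k) (streams A + 2 + j)"
  shows "slot_at L t (land c j) = slot (Suc c) (int k + int (delay A c j)) j"
proof -
  let ?l = "int S * (int (lag A c) - int (lag A (Suc c)) - int (delay A c j)) + int (streams A) + 2"
  have "int t mod int L
      = (int S * (int k + int (lag A c)) + int (streams A + 2 + j)) mod int L"
    using assms L_pos unfolding slot_def
    by (metis zmod_int int_nat_eq pos_mod_sign of_nat_0_less_iff)
  moreover have "int (land c j) mod int L = ?l mod int L"
    using L_pos by (simp add: land_def)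
  ultimately have "(int t - int (land c j)) mod int L
      = (int S * (int k + int (lag A c)) + int (streams A + 2 + j) - ?l) mod int L"
    by (rule mod_diff_cong)
  also have "\<dots> = (int S * (int k + int (delay A c j) + int (lag A (Suc c))) + int j) mod int L"
    by (simp add: algebra_simps)
  finally show ?thesis by (simp add: slot_at_def slot_def)
qed

section \<open>Contents of the initial load\<close>

text \<open>Block numbers \<open>k + lag A c\<close> of actual beats are below \<open>N\<close>, so
  \<open>div\<close> and \<open>mod\<close> by \<open>S\<close> recover beat and place without
  wrapping.\<close>

lemma init_load_Op_iff:
  assumes "c < cells A"
  shows "init_load c i = Op h ds e \<longleftrightarrow>
    (\<exists>k<beats A. i = slot c (int k) (streams A + 1) \<and> h = opcode A c k \<and> ds = operands c k \<and> e = 1)"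
    (is "?lhs \<longleftrightarrow> ?rhs")
proof
  assume ?lhs
  hence v: "i mod S = streams A + 1" and b: "lag A c \<le> i div S" "i div S - lag A c < beats A"
    and h: "h = opcode A c (i div S - lag A c)" "ds = operands c (i div S - lag A c)" "e = 1"
    by (auto simp: init_load_def Let_def split: if_splits)
  have "slot c (int (i div S - lag A c)) (streams A + 1) = S * (i div S) + i mod S"
    using b v beat_less_N[OF assms b(2)] by (subst slot_nat) (auto simp: S_def)
  thus ?rhs using b h by (intro exI[of _ "i div S - lag A c"]) simp
next
  assume ?rhs
  then obtain k where k: "k < beats A" and i: "i = slot c (int k) (streams A + 1)"
    and h: "h = opcode A c k" "ds = operands c k" "e = 1" by blast
  have v: "streams A + 1 < S" by (simp add: S_def)
  have "i = S * (k + lag A c) + (streams A + 1)"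
    unfolding i using beat_less_N[OF assms k] v by (rule slot_nat)
  hence "i mod S = streams A + 1" "i div S = k + lag A c"
    using place_div_mod[OF v] by simp_all
  thus ?lhs using k h by (simp add: init_load_def Let_def)
qed

lemma init_load_Transfer_iff:
  assumes "c < cells A"
  shows "init_load c i = Transfer d p \<longleftrightarrow>
    (\<exists>k<beats A. \<exists>j<streams A. Suc c < cells A \<and> i = slot c (int k) (streams A + 2 + j) \<and>
       d = streams A + 2 + j - src_place c j \<and> p = land c j)"
    (is "?lhs \<longleftrightarrow> ?rhs")
proof
  assume ?lhs
  hence v: "streams A + 2 \<le> i mod S" and b: "lag A c \<le> i div S" "i div S - lag A c < beats A"
    and h: "Suc c < cells A" "d = i mod S - src_place c (i mod S - (streams A + 2))"
      "p = land c (i mod S - (streams A + 2))"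
    by (auto simp: init_load_def Let_def split: if_splits)
  obtain j where j: "i mod S = streams A + 2 + j"
    using v le_Suc_ex by blast
  have "i mod S < S" using S_pos by simp
  hence "j < streams A" unfolding j by (simp add: S_def)
  have "slot c (int (i div S - lag A c)) (i mod S) = i"
    using b beat_less_N[OF assms b(2)] S_pos by (subst slot_nat) auto
  hence "i = slot c (int (i div S - lag A c)) (streams A + 2 + j)"
    unfolding j by (rule sym)
  moreover have "d = streams A + 2 + j - src_place c j" "p = land c j"
    using h(2,3) unfolding j by simp_all
  ultimately show ?rhs using b(2) h(1) \<open>j < streams A\<close> by blast
next
  assume ?rhs
  then obtain k j where k: "k < beats A" and j: "j < streams A"
    and i: "i = slot c (int k) (streams A + 2 + j)" and h: "Suc c < cells A"
      "d = streams A + 2 + j - src_place c j" "p = land c j" by blast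
  have v: "streams A + 2 + j < S" using j by (simp add: S_def)
  have "i = S * (k + lag A c) + (streams A + 2 + j)"
    unfolding i using beat_less_N[OF assms k] v by (rule slot_nat)
  hence "i mod S = streams A + 2 + j" "i div S = k + lag A c"
    using place_div_mod[OF v] by simp_all
  thus ?lhs using k h by (simp add: init_load_def Let_def)
qed

lemma init_load_stream:
  assumes "in_range c k" "j < streams A"
  shows "init_load c (slot c k j) = Val (j, k)"
proof -
  have j: "j < S" using assms by (simp add: S_def)
  have N: "\<rho> \<le> N" by (auto simp: N_def)
  define b where "b = nat ((k + int (lag A c)) mod int N)"
  have b: "int b = (k + int (lag A c)) mod int N" using N_pos by (simp add: b_def)
  have "(if b < N - \<rho> then int b else int b - int N) = k + int (lag A c)"
  \<comment> \<open>The sign of the block number decides, not that of the beat: with a positive lag,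
    some negative beats lie in the first \<open>lag A c\<close> blocks and do not wrap.\<close>
  proof (cases "0 \<le> k + int (lag A c)")
    case True
    hence "int b = k + int (lag A c)"
      using assms(1) N unfolding b by (intro mod_pos_pos_trivial) (auto simp: in_range_def)
    thus ?thesis using assms(1) by (auto simp: in_range_def)
  next
    case False
    have "int b = (k + int (lag A c) + int N) mod int N" by (simp add: b)
    also have "\<dots> = k + int (lag A c) + int N"
      using False assms(1) N by (intro mod_pos_pos_trivial) (auto simp: in_range_def)
    finally show ?thesis using False assms(1) N by (auto simp: in_range_def)
  qed
  moreover have "init_load c (slot c k j)
      = Val (j, (if b < N - \<rho> then int b else int b - int N) - int (lag A c))"
    using assms(2) unfolding init_load_def Let_def slot_div_mod[OF j] b_def[symmetric] by simp
  ultimately show ?thesis by simp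
qed

section \<open>Verification of the embedding\<close>

lemma embedding: "embedding (S * (\<rho> + 1)) S \<rho> A M Y"
  unfolding embedding_def Let_def
proof (intro conjI allI impI)
  \<comment> \<open>The window spans \<open>\<rho>\<close> blocks and one more: an operand is at
    most \<open>S * \<rho> + streams A + 1\<close> slots ahead, and the source of a transfer fewer
    than \<open>S\<close>.\<close>
  have W: "S * (\<rho> + 1) < L"
    unfolding L_def using S_pos by (intro mult_strict_left_mono) (auto simp: N_def)
  show "machine_wf (S * (\<rho> + 1)) M"
    unfolding machine_wf_def
  proof (intro allI impI conjI)
    fix c i assume c: "c < rings M" and i: "i < len M c"
    show "case load M c i of Op h ds e \<Rightarrow> (\<forall>d\<in>set ds. d \<le> S * (\<rho> + 1)) \<and> e \<le> S * (\<rho> + 1)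
      | Transfer d p \<Rightarrow> d \<le> S * (\<rho> + 1) \<and> Suc c < rings M \<and> p < len M (Suc c) | _ \<Rightarrow> True"
    proof (cases "init_load c i")
      case (Op h ds e)
      then obtain k where k: "k < beats A" "ds = operands c k" "e = 1"
        using c by (auto simp: init_load_Op_iff)
      have "S * o' + streams A + 1 - j \<le> S * (\<rho> + 1)" if "(j, o') \<in> set (reads A c k)" for j o'
      proof -
        have "S * o' \<le> S * \<rho>" using reads_bound[OF _ k(1) that] c by simp
        thus ?thesis by (simp add: S_def)
      qed
      thus ?thesis using Op k by (auto simp: operands_def S_def)
    next
      case (Transfer d p)
      then obtain j where "j < streams A" "Suc c < cells A"
        "d = streams A + 2 + j - src_place c j" "p = land c j"
        using c by (auto simp: init_load_Transfer_iff)
      moreover have "land c j < L" using L_pos by (simp add: land_def nat_less_iff)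
      ultimately show ?thesis using Transfer by (simp add: S_def)
    qed auto
  qed (use W L_pos in auto)
  show "S * (\<rho> + beats A) \<le> len M c" for c
    unfolding M_simps L_def by (intro mult_le_mono) (auto simp: N_def)
  show "distinct (op_place Y # res_place Y #
      map (str_place Y) [0..<streams A] @ map (tr_place Y) [0..<streams A])"
    by (auto simp: distinct_map inj_on_def)
  show "\<forall>v\<in>set (op_place Y # res_place Y #
      map (str_place Y) [0..<streams A] @ map (tr_place Y) [0..<streams A]). v < S"
    by (auto simp: S_def)
next
  fix c k assume c: "c < cells A" and k: "k < beats A"
  let ?i = "block_slot S M Y c (int k) (op_place Y)"
  have i: "?i = slot c (int k) (streams A + 1)" by simp
  have "map (ahead L ?i) (operands c k) = map (\<lambda>(j, o'). slot c (int k - int o') j) (reads A c k)"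
    unfolding operands_def map_map i
  proof (rule map_cong[OF refl], clarsimp)
    fix j o' assume "(j, o') \<in> set (reads A c k)"
    hence "j < streams A" using reads_bound c k by blast
    thus "ahead L (slot c (int k) (Suc (streams A))) (Suc (S * o' + streams A) - j)
        = slot c (int k - int o') j"
      by (intro ahead_slot) (simp add: algebra_simps of_nat_diff)
  qed
  moreover have "ahead L ?i 1 = slot c (int k) (streams A)"
    unfolding i by (intro ahead_slot) simp
  ultimately show "\<exists>ds e. load M c ?i = Op (opcode A c k) ds e \<and>
      map (ahead (len M c) ?i) ds
        = map (\<lambda>(j, o'). block_slot S M Y c (int k - int o') (str_place Y j)) (reads A c k) \<and>
      ahead (len M c) ?i e = block_slot S M Y c (int k) (res_place Y)"
    using init_load_Op_iff[OF c] k by (intro exI[of _ "operands c k"] exI[of _ 1]) auto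
  have "slot c (int k) (streams A + 1) = S * (k + lag A c) + (streams A + 1)"
    using beat_less_N[OF c k] by (intro slot_nat) (auto simp: S_def)
  thus "slot_at (len M c) (S * (k + lag A c) + op_place Y) (op_pos M c) = ?i"
    using slot_less[of c "int k" "streams A + 1"] by (simp add: slot_at_0)
next
  fix c j k assume c: "Suc c < cells A" and j: "j < streams A" and k: "k < beats A"
  let ?i = "block_slot S M Y c (int k) (tr_place Y j)"
  have i: "?i = slot c (int k) (streams A + 2 + j)" by simp
  have "ahead L ?i (streams A + 2 + j - src_place c j) = slot c (int k) (src_place c j)"
    unfolding i using src_place_le[OF c j] by (intro ahead_slot) (simp add: of_nat_diff)
  moreover have "init_load c ?i = Transfer (streams A + 2 + j - src_place c j) (land c j)"
    using c k j unfolding i by (subst init_load_Transfer_iff) auto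
  ultimately show "\<exists>d. load M c ?i = Transfer d (landing Y c j) \<and>
      ahead (len M c) ?i d = block_slot S M Y c (int k)
        (case source A c j of Result \<Rightarrow> res_place Y | Forward i' \<Rightarrow> str_place Y i')"
    by (auto simp: src_place_def split: source.splits)
  \<comment> \<open>The cycle in which the transfer instruction of this beat passes position
    \<open>0\<close>; its place is below \<open>S\<close>, so the cycle falls within the
    beat.\<close>
  let ?t = "S * (k + lag A c) + (streams A + 2 + j)"
  have "slot c (int k) (streams A + 2 + j) = ?t"
    using beat_less_N[of c k] c k j by (intro slot_nat) (auto simp: S_def)
  hence t: "?t mod L = slot c (int k) (streams A + 2 + j)"
    using slot_less[of c "int k" "streams A + 2 + j"] by simp
  show "\<exists>t\<ge>S * (k + lag A c). t < S * (k + lag A c + 1) \<and>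
      slot_at (len M c) t (tr_pos M c) = ?i \<and>
      slot_at (len M (Suc c)) t (landing Y c j) =
        block_slot S M Y (Suc c) (int k + int (delay A c j)) (str_place Y j)"
  proof (intro exI[of _ ?t] conjI)
    show "?t < S * (k + lag A c + 1)" using j by (simp add: S_def)
    show "slot_at (len M c) ?t (tr_pos M c) = ?i" using t by (simp add: slot_at_0)
    show "slot_at (len M (Suc c)) ?t (landing Y c j) =
        block_slot S M Y (Suc c) (int k + int (delay A c j)) (str_place Y j)"
      using slot_at_land[OF t] by simp
  qed simp
qed simp

lemma no_transfers: "cells A = 1 \<Longrightarrow> no_transfers M"
  by (simp add: no_transfers_def init_load_Transfer_iff)

section \<open>Stability of the instructions and the writes of a cycle\<close>

text \<open>Only instructions are compared, since data slots change. The equivalences also exclude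
  that a written packet becomes a new instruction.\<close>

definition same_instr :: "('op, 'v) state \<Rightarrow> bool" where
  "same_instr \<sigma> \<longleftrightarrow> (\<forall>c<cells A. \<forall>i<L.
     (\<forall>h ds e. \<sigma> c i = Op h ds e \<longleftrightarrow> init_load c i = Op h ds e) \<and>
     (\<forall>d p. \<sigma> c i = Transfer d p \<longleftrightarrow> init_load c i = Transfer d p))"

definition op_result ::
  "('op \<Rightarrow> 'v option \<Rightarrow> 'v list \<Rightarrow> 'v) \<Rightarrow> (nat \<Rightarrow> 'v option) \<Rightarrow> ('op, 'v) state \<Rightarrow> nat \<Rightarrow> nat \<Rightarrow>
   ('op, 'v) packet" where
  "op_result f w \<sigma> c k = operate f (w c) (opcode A c k)
     (map (\<lambda>(j, o'). \<sigma> c (slot c (int k - int o') j)) (reads A c k))"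

text \<open>In cycle \<open>t\<close> the station sees slot \<open>t mod L\<close>. With the
  instructions intact, the initial load tells which beat, if any, has its operation there.\<close>

lemma op_write_iff:
  assumes "same_instr \<sigma>" and c: "c < cells A"
  shows "op_write M f w t \<sigma> c = Some (i, p) \<longleftrightarrow>
    (\<exists>k<beats A. t mod L = slot c (int k) (streams A + 1) \<and>
       i = slot c (int k) (streams A) \<and> p = op_result f w \<sigma> c k)"
proof -
  have *: "\<sigma> c (t mod L) = Op h ds e \<longleftrightarrow> (\<exists>k<beats A. t mod L = slot c (int k) (streams A + 1) \<and>
      h = opcode A c k \<and> ds = operands c k \<and> e = 1)" for h ds e
    using assms L_pos init_load_Op_iff[OF c] by (simp add: same_instr_def)
  have r: "ahead L (slot c (int k) (streams A + 1)) 1 = slot c (int k) (streams A)" for k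
    by (intro ahead_slot) simp
  have s: "operate f (w c) (opcode A c k)
      (map (\<lambda>d. \<sigma> c (ahead L (slot c (int k) (streams A + 1)) d)) (operands c k))
      = op_result f w \<sigma> c k" if k: "k < beats A" for k
    unfolding op_result_def operands_def map_map
  proof (rule arg_cong[where f = "operate f (w c) (opcode A c k)"], rule map_cong[OF refl], clarify)
    fix j o' assume "(j, o') \<in> set (reads A c k)"
    hence "j < streams A" using reads_bound c k by blast
    hence "ahead L (slot c (int k) (streams A + 1)) (S * o' + streams A + 1 - j)
        = slot c (int k - int o') j"
      by (intro ahead_slot) (simp add: algebra_simps of_nat_diff)
    thus "((\<lambda>d. \<sigma> c (ahead L (slot c (int k) (streams A + 1)) d)) \<circ>
        (\<lambda>(j, o'). S * o' + streams A + 1 - j)) (j, o') = \<sigma> c (slot c (int k - int o') j)"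
      by simp
  qed
  have "op_write M f w t \<sigma> c = Some (i, p) \<longleftrightarrow> (\<exists>h ds e. \<sigma> c (t mod L) = Op h ds e \<and>
      i = ahead L (t mod L) e \<and>
      p = operate f (w c) h (map (\<lambda>d. \<sigma> c (ahead L (t mod L) d)) ds))"
    by (auto simp: op_write_def Let_def slot_at_0 split: packet.splits)
  also have "\<dots> \<longleftrightarrow> (\<exists>k<beats A. t mod L = slot c (int k) (streams A + 1) \<and>
       i = slot c (int k) (streams A) \<and> p = op_result f w \<sigma> c k)"
    unfolding * using r s by (auto simp del: One_nat_def) metis+
  finally show ?thesis .
qed

lemma tr_write_iff:
  assumes "same_instr \<sigma>" and c: "Suc c < cells A"
  shows "tr_write M t \<sigma> c = Some (i, p) \<longleftrightarrow>
    (\<exists>k<beats A. \<exists>j<streams A. t mod L = slot c (int k) (streams A + 2 + j) \<and>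
       i = slot (Suc c) (int k + int (delay A c j)) j \<and> p = \<sigma> c (slot c (int k) (src_place c j)))"
proof -
  have *: "\<sigma> c (t mod L) = Transfer d q \<longleftrightarrow> (\<exists>k<beats A. \<exists>j<streams A.
      t mod L = slot c (int k) (streams A + 2 + j) \<and>
      d = streams A + 2 + j - src_place c j \<and> q = land c j)" for d q
    using assms L_pos init_load_Transfer_iff[of c] by (simp add: same_instr_def)
  have r: "ahead L (slot c (int k) (streams A + 2 + j)) (streams A + 2 + j - src_place c j)
      = slot c (int k) (src_place c j)" if "j < streams A" for k j
    using src_place_le[OF c that] by (intro ahead_slot) (simp add: of_nat_diff)
  have "tr_write M t \<sigma> c = Some (i, p) \<longleftrightarrow> (\<exists>d q. \<sigma> c (t mod L) = Transfer d q \<and>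
      i = slot_at L t q \<and> p = \<sigma> c (ahead L (t mod L) d))"
    by (auto simp: tr_write_def Let_def slot_at_0 split: packet.splits)
  also have "\<dots> \<longleftrightarrow> (\<exists>k<beats A. \<exists>j<streams A. t mod L = slot c (int k) (streams A + 2 + j) \<and>
      i = slot_at L t (land c j) \<and>
      p = \<sigma> c (ahead L (t mod L) (streams A + 2 + j - src_place c j)))"
    unfolding * by blast
  also have "\<dots> \<longleftrightarrow> (\<exists>k<beats A. \<exists>j<streams A. t mod L = slot c (int k) (streams A + 2 + j) \<and>
       i = slot (Suc c) (int k + int (delay A c j)) j \<and> p = \<sigma> c (slot c (int k) (src_place c j)))"
    by (intro ex_cong1 conj_cong refl) (simp_all only: r slot_at_land)
  finally show ?thesis .
qed

text \<open>Data occupy the residues up to \<open>streams A\<close> modulo \<open>S\<close>,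
  instructions the larger ones.\<close>

lemma init_load_data:
  assumes "c < cells A" "v \<le> streams A"
  shows "init_load c (slot c k v) \<noteq> Op h ds e" "init_load c (slot c k v) \<noteq> Transfer d p"
proof -
  have *: "slot c k v \<noteq> slot c k' v'" if "streams A < v'" "v' < S" for k' v'
    using slot_div_mod(2)[of v c k] slot_div_mod(2)[of v' c k'] assms that by auto
  have "slot c k v \<noteq> slot c k' (streams A + 1)" for k'
    by (intro *) (auto simp: S_def)
  moreover have "slot c k v \<noteq> slot c k' (streams A + 2 + j)" if "j < streams A" for k' j
    using that by (intro *) (auto simp: S_def)
  ultimately show "init_load c (slot c k v) \<noteq> Op h ds e" "init_load c (slot c k v) \<noteq> Transfer d p"
    unfolding init_load_Op_iff[OF assms(1)] init_load_Transfer_iff[OF assms(1)]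
    by blast+
qed

text \<open>The case \<open>stay\<close> records that no write hits the slot at all. This is how a
  missing write later shows that its instruction does not fire in cycle \<open>t\<close>.\<close>

lemma step_cases:
  obtains (stay) "step M f w t \<sigma> c i = \<sigma> c i"
      "\<And>p. op_write M f w t \<sigma> c \<noteq> Some (i, p)"
      "\<And>b p. c = Suc b \<Longrightarrow> tr_write M t \<sigma> b \<noteq> Some (i, p)"
  | (operated) "op_write M f w t \<sigma> c = Some (i, step M f w t \<sigma> c i)"
  | (landed) b where "c = Suc b" "tr_write M t \<sigma> b = Some (i, step M f w t \<sigma> c i)"
  by (cases c; cases "op_write M f w t \<sigma> c"; cases "tr_write M t \<sigma> (c - 1)")
    (fastforce simp: step_def Let_def split: if_splits)+

lemma same_instr_step:
  assumes \<sigma>: "same_instr \<sigma>"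
  shows "same_instr (step M f w t \<sigma>)"
  unfolding same_instr_def
proof (intro allI impI)
  fix c i assume c: "c < cells A" and i: "i < L"
  show "(\<forall>h ds e. step M f w t \<sigma> c i = Op h ds e \<longleftrightarrow> init_load c i = Op h ds e) \<and>
    (\<forall>d p. step M f w t \<sigma> c i = Transfer d p \<longleftrightarrow> init_load c i = Transfer d p)"
  proof (cases rule: step_cases[of f w t \<sigma> c i])
    case stay
    thus ?thesis using \<sigma> c i by (simp add: same_instr_def)
  next
    case operated
    then obtain k where "i = slot c (int k) (streams A)" "step M f w t \<sigma> c i = op_result f w \<sigma> c k"
      unfolding op_write_iff[OF \<sigma> c] by blast
    thus ?thesis using init_load_data[OF c order_refl]
      by (simp add: op_result_def operate_def)
  next
    case (landed b)
    then obtain k j where j: "j < streams A" "i = slot c (int k + int (delay A b j)) j"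
      and s: "step M f w t \<sigma> c i = \<sigma> b (slot b (int k) (src_place b j))"
      using c by (auto simp: tr_write_iff[OF \<sigma>])
    \<comment> \<open>The copied packet comes from a data place, so by the invariant it is not an
      instruction.\<close>
    have "b < cells A" "src_place b j \<le> streams A" using landed(1) c src_place_le j(1) by auto
    hence "\<sigma> b (slot b (int k) (src_place b j)) \<noteq> Op h ds e"
      "\<sigma> b (slot b (int k) (src_place b j)) \<noteq> Transfer d p" for h ds e d p
      using \<sigma> init_load_data[of b "src_place b j" "int k"] slot_less by (auto simp: same_instr_def)
    thus ?thesis using s j init_load_data[OF c, of j] by simp
  qed
qed

lemma map_packet_eq_instr:
  "map_packet id g p = Op h ds e \<longleftrightarrow> p = Op h ds e"
  "map_packet id g p = Transfer d q \<longleftrightarrow> p = Transfer d q"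
  by (cases p; simp)+

lemma same_instr_run: "same_instr (run M f w x t)"
proof (induction t)
  case 0
  show ?case by (simp add: same_instr_def map_packet_eq_instr)
qed (simp add: same_instr_step)

section \<open>Correctness of the data by induction on time\<close>

text \<open>
  Stream \<open>j\<close> of cell \<open>c\<close> at beat \<open>k\<close> is in its slot from the start, unless it is sent by a transfer of
  cell \<open>c - 1\<close>, which then must have fired before cycle \<open>t\<close>.
\<close>

definition ready :: "nat \<Rightarrow> nat \<Rightarrow> int \<Rightarrow> nat \<Rightarrow> bool" where
  "ready c j k t \<longleftrightarrow> (\<forall>b. c = Suc b \<longrightarrow> int (delay A b j) \<le> k \<longrightarrow>
     int S * (k - int (delay A b j) + int (lag A b)) + int (streams A) + 2 + int j < int t)"

text \<open>The states are those at the start of cycle \<open>t\<close>, hence the strict bound: the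
  operation of beat \<open>k\<close> fires in cycle \<open>S * (k + lag A c) + streams A + 1\<close>
  and its result shows one cycle later. Values landing beyond the last beat are not tracked.\<close>

definition correct ::
  "('op \<Rightarrow> 'v option \<Rightarrow> 'v list \<Rightarrow> 'v) \<Rightarrow> (nat \<Rightarrow> 'v option) \<Rightarrow> (nat \<Rightarrow> nat \<Rightarrow> int \<Rightarrow> 'v) \<Rightarrow>
   nat \<Rightarrow> ('op, 'v) state \<Rightarrow> bool" where
  "correct f w x t \<sigma> \<longleftrightarrow> (\<forall>c<cells A.
     (\<forall>j<streams A. \<forall>k. - int \<rho> \<le> k \<longrightarrow> k < int (beats A) \<longrightarrow> ready c j k t \<longrightarrow>
        \<sigma> c (slot c k j) = Val (stream A f w x c j k)) \<and>
     (\<forall>k<beats A. S * (k + lag A c) + streams A + 1 < t \<longrightarrow>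
        \<sigma> c (slot c (int k) (streams A)) = Val (cell_output A f w x c k)))"

text \<open>By \<open>lag_Suc\<close> the sending transfer is at least one block earlier, and its
  place exceeds that of the operation by \<open>j + 1\<close>, which is less than
  \<open>S\<close>.\<close>

lemma ready_at_op:
  assumes "j < streams A" "int S * (k + int (lag A c)) + int (streams A) + 1 \<le> int t"
  shows "ready c j k t"
  unfolding ready_def
proof (intro allI impI)
  fix b assume b: "c = Suc b"
  have "int S * (k - int (delay A b j) + int (lag A b)) \<le> int S * (k + int (lag A c) - 1)"
    using lag_Suc[OF assms(1), of b] b by (intro mult_left_mono) auto
  also have "\<dots> = int S * (k + int (lag A c)) - int S" by (simp add: algebra_simps)
  finally show "int S * (k - int (delay A b j) + int (lag A b)) + int (streams A) + 2 + int j < int t"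
    using assms by (simp add: S_def)
qed

text \<open>Up to the horizon \<open>S * (beats A + cells A)\<close>, which is at most
  \<open>L\<close>, no slot passes the stations twice, so each instruction fires at most
  once.\<close>

lemma time_mod_eq:
  assumes "t < S * (beats A + cells A)" "c < cells A" "k < beats A" "v < S"
  shows "t mod L = slot c (int k) v \<longleftrightarrow> t = S * (k + lag A c) + v"
proof -
  have "S * (beats A + cells A) \<le> L" unfolding L_def by (intro mult_le_mono) (auto simp: N_def)
  thus ?thesis using assms slot_nat[OF beat_less_N] by simp
qed

lemma op_result_correct:
  assumes \<sigma>: "correct f w x t \<sigma>" and c: "c < cells A" and k: "k < beats A"
    and t: "t = S * (k + lag A c) + streams A + 1"
  shows "op_result f w \<sigma> c k = Val (cell_output A f w x c k)"
proof -
  have "\<sigma> c (slot c (int k - int o') j) = Val (stream A f w x c j (int k - int o'))"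
    if "(j, o') \<in> set (reads A c k)" for j o'
  proof -
    have j: "j < streams A" "o' \<le> \<rho>" using reads_bound[OF c k that] by auto
    have "int S * (int k - int o' + int (lag A c)) \<le> int S * (int k + int (lag A c))"
      by (intro mult_left_mono) auto
    hence "ready c j (int k - int o') t" using j t by (intro ready_at_op) auto
    thus ?thesis using \<sigma> c j k by (simp add: correct_def)
  qed
  hence "map (\<lambda>(j, o'). \<sigma> c (slot c (int k - int o') j)) (reads A c k)
      = map Val (map (\<lambda>(j, o'). stream A f w x c j (int k - int o')) (reads A c k))"
    by auto
  thus ?thesis unfolding op_result_def
    by (simp only:) (simp add: operate_def comp_def cell_output_def apply_cell_def)
qed

text \<open>Transfers follow the operation within a block. So the result is already written, and a
  forwarded stream value, ready when the operation fires, is still ready.\<close>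

lemma landed_correct:
  assumes \<sigma>: "correct f w x t \<sigma>" and c: "Suc c < cells A" and k: "k < beats A"
    and j: "j < streams A" and t: "t = S * (k + lag A c) + streams A + 2 + j"
  shows "\<sigma> c (slot c (int k) (src_place c j))
    = Val (stream A f w x (Suc c) j (int k + int (delay A c j)))"
proof (cases "source A c j")
  case Result
  thus ?thesis using \<sigma> c k t by (simp add: correct_def src_place_def cell_output_def)
next
  case (Forward i)
  hence i: "i < streams A" using wf c j by (auto simp: systolic_wf_def)
  hence "ready c i (int k) t" using t by (intro ready_at_op) auto
  thus ?thesis using Forward \<sigma> c k i by (simp add: correct_def src_place_def)
qed

text \<open>A tracked slot is either written in this cycle, and then with the right value, or left
  alone, and then its value was already due before.\<close>

lemma correct_step:
  assumes \<sigma>: "correct f w x t \<sigma>" "same_instr \<sigma>" and t: "t < S * (beats A + cells A)"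
  shows "correct f w x (Suc t) (step M f w t \<sigma>)"
  unfolding correct_def
proof (intro allI impI conjI)
  fix c j k assume c: "c < cells A" and j: "j < streams A"
    and k: "- int \<rho> \<le> k" "k < int (beats A)" and rd: "ready c j k (Suc t)"
  have jS: "j < S" "streams A < S" using j by (simp_all add: S_def)
  show "step M f w t \<sigma> c (slot c k j) = Val (stream A f w x c j k)"
  proof (cases rule: step_cases[of f w t \<sigma> c "slot c k j"])
    case stay
    \<comment> \<open>If the value became ready only in this cycle, its transfer would fire now and
      write the slot, contrary to \<open>stay\<close>.\<close>
    have "ready c j k t"
      unfolding ready_def
    proof (intro allI impI)
      fix b assume b: "c = Suc b" and d: "int (delay A b j) \<le> k"
      define k' where "k' = nat (k - int (delay A b j))"
      have k': "k = int k' + int (delay A b j)" "k' < beats A" using d k by (auto simp: k'_def)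
      have eq: "int S * (k - int (delay A b j) + int (lag A b)) + int (streams A) + 2 + int j
          = int (S * (k' + lag A b) + (streams A + 2 + j))"
        using k' by simp
      have "t \<noteq> S * (k' + lag A b) + (streams A + 2 + j)"
        using stay(3)[OF b] time_mod_eq[OF t, of b k' "streams A + 2 + j"] b c j k'
        by (auto simp: tr_write_iff[OF \<sigma>(2)] S_def)
      moreover have "S * (k' + lag A b) + (streams A + 2 + j) < Suc t"
        using rd b d eq unfolding ready_def by (metis of_nat_less_iff)
      ultimately show "int S * (k - int (delay A b j) + int (lag A b)) + int (streams A) + 2 + int j
          < int t"
        unfolding eq of_nat_less_iff by simp
    qed
    thus ?thesis using stay(1) \<sigma>(1) c j k by (simp add: correct_def)
  next
    case operated
    then obtain k' where "slot c k j = slot c (int k') (streams A)"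
      unfolding op_write_iff[OF \<sigma>(2) c] by blast
    hence False
      using slot_div_mod(2)[OF jS(1), of c k] slot_div_mod(2)[OF jS(2), of c "int k'"] j by simp
    thus ?thesis ..
  next
    case (landed b)
    then obtain k' j' where k': "k' < beats A" and j': "j' < streams A"
      and at: "t mod L = slot b (int k') (streams A + 2 + j')"
      and eq: "slot c k j = slot c (int k' + int (delay A b j')) j'"
      and v: "step M f w t \<sigma> c (slot c k j) = \<sigma> b (slot b (int k') (src_place b j'))"
      using c by (auto simp: tr_write_iff[OF \<sigma>(2)])
    \<comment> \<open>The landing beat may exceed the last beat but is still in range, so slot
      equality identifies the beats and not merely their residues.\<close>
    have "k = int k' + int (delay A b j')" "j = j'"
      using slot_inj[OF eq jS(1)] in_range_beat[OF c k] in_range_target[of b j' k'] landed(1) c j' k'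
      by (auto simp: S_def)
    moreover have "t = S * (k' + lag A b) + streams A + 2 + j'"
      using at time_mod_eq[OF t, of b k' "streams A + 2 + j'"] landed(1) c j' k' by (simp add: S_def)
    ultimately show ?thesis
      using v landed_correct[OF \<sigma>(1), of b k' j'] landed(1) c k' j' by simp
  qed
next
  fix c k assume c: "c < cells A" and k: "k < beats A"
    and le: "S * (k + lag A c) + streams A + 1 < Suc t"
  have S: "streams A < S" "streams A + 1 < S" by (simp_all add: S_def)
  show "step M f w t \<sigma> c (slot c (int k) (streams A)) = Val (cell_output A f w x c k)"
  proof (cases rule: step_cases[of f w t \<sigma> c "slot c (int k) (streams A)"])
    case stay
    \<comment> \<open>Otherwise the operation of beat \<open>k\<close> would fire now and write this
      slot.\<close>
    have "t \<noteq> S * (k + lag A c) + (streams A + 1)"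
      using stay(2) time_mod_eq[OF t c k S(2)] k unfolding op_write_iff[OF \<sigma>(2) c] by blast
    thus ?thesis using stay(1) \<sigma>(1) c k le by (simp add: correct_def)
  next
    case operated
    then obtain k' where k': "k' < beats A" "t mod L = slot c (int k') (streams A + 1)"
      and eq: "slot c (int k) (streams A) = slot c (int k') (streams A)"
      and v: "step M f w t \<sigma> c (slot c (int k) (streams A)) = op_result f w \<sigma> c k'"
      unfolding op_write_iff[OF \<sigma>(2) c] by blast
    have "k = k'"
      using slot_inj(1)[OF eq S(1) S(1)] in_range_beat[OF c] k k'(1) by simp
    moreover have "t = S * (k' + lag A c) + streams A + 1"
      using k' time_mod_eq[OF t c k'(1) S(2)] by simp
    ultimately show ?thesis using v op_result_correct[OF \<sigma>(1) c k] by simp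
  next
    case (landed b)
    then obtain k' j' where "j' < streams A" "slot c (int k) (streams A) = slot c k' j'"
      using c by (auto simp: tr_write_iff[OF \<sigma>(2)])
    hence False
      using slot_div_mod(2)[OF S(1), of c "int k"] slot_div_mod(2)[of j' c k'] S(1) by simp
    thus ?thesis ..
  qed
qed

lemma correct_run: "t \<le> S * (beats A + cells A) \<Longrightarrow> correct f w x t (run M f w x t)"
proof (induction t)
  case 0
  \<comment> \<open>No transfer has fired before cycle \<open>0\<close>, so a value that is ready
    then precedes everything sent and is a boundary datum.\<close>
  have "ready c j k 0 \<Longrightarrow> - int \<rho> \<le> k \<Longrightarrow> stream A f w x c j k = x c j k" for c j k
  proof (cases c)
    case (Suc b)
    assume rd: "ready c j k 0"
    have "k < int (delay A b j)"
    proof (rule ccontr)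
      assume "\<not> k < int (delay A b j)"
      hence "0 \<le> int S * (k - int (delay A b j) + int (lag A b))"
        and "int S * (k - int (delay A b j) + int (lag A b)) + int (streams A) + 2 + int j < 0"
        using rd Suc by (simp_all add: ready_def)
      thus False by linarith
    qed
    thus ?thesis using Suc by simp
  qed simp
  thus ?case
    by (auto simp: correct_def init_load_stream in_range_beat)
next
  case (Suc t)
  thus ?case by (simp add: correct_step same_instr_run)
qed

section \<open>Reading off the computed streams\<close>

lemma computes: "computes S \<rho> A M Y f w x"
  unfolding computes_def
proof (intro allI impI conjI)
  fix c k assume c: "c < cells A" and k: "k < beats A"
  have le: "S * (k + lag A c + 1) \<le> S * (beats A + cells A)"
    using lag_bound[OF c] k by (intro mult_le_mono) auto
  {
    fix j o' assume j: "j < streams A" "o' \<le> \<rho>"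
    let ?t = "S * (k + lag A c) + streams A + 1"
    have "int S * (int k - int o' + int (lag A c)) \<le> int S * (int k + int (lag A c))"
      by (intro mult_left_mono) auto
    hence "ready c j (int k - int o') ?t" using j by (intro ready_at_op) auto
    moreover have "?t \<le> S * (beats A + cells A)" using le by (simp add: S_def)
    ultimately show "run M f w x (S * (k + lag A c) + op_place Y) c
        (block_slot S M Y c (int k - int o') (str_place Y j)) =
        Val (stream A f w x c j (int k - int o'))"
      using correct_run[of ?t f w x] c j k by (simp add: correct_def)
  next
    fix t assume t: "S * (k + lag A c + 1) \<le> t" "t \<le> S * (beats A + lag A (cells A - 1))"
    \<comment> \<open>The end of the last beat of the last cell lies within the horizon of
      \<open>correct_run\<close>.\<close>
    have "S * (beats A + lag A (cells A - 1)) \<le> S * (beats A + cells A)"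
      using lag_le[of "cells A - 1"] by (intro mult_le_mono) auto
    with t(2) have "t \<le> S * (beats A + cells A)" by (rule order_trans)
    moreover have "S * (k + lag A c) + streams A + 1 < t"
      using t(1) by (simp add: S_def)
    ultimately show "run M f w x t c (block_slot S M Y c (int k) (res_place Y)) =
        Val (cell_output A f w x c k)"
      using correct_run[of t f w x] c k by (simp add: correct_def)
  }
qed

end

section \<open>Uniform window and slowdown\<close>

theorem proposition3:
  fixes r \<rho> s :: nat
  shows "\<exists>W S. 0 < S \<and>
    (\<forall>A :: 'op systolic. systolic_wf r \<rho> A \<longrightarrow> streams A = s \<longrightarrow>
       (\<exists>M Y. embedding W S \<rho> A M Y \<and>
          (\<forall>(f :: 'op \<Rightarrow> 'v option \<Rightarrow> 'v list \<Rightarrow> 'v) w x. computes S \<rho> A M Y f w x))) \<and>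
    (\<forall>A :: 'op systolic. systolic_wf r \<rho> A \<longrightarrow> streams A = s \<longrightarrow> cells A = 1 \<longrightarrow>
       (\<exists>M Y. embedding W S \<rho> A M Y \<and> rings M = 1 \<and> no_transfers M \<and>
          (\<forall>(f :: 'op \<Rightarrow> 'v option \<Rightarrow> 'v list \<Rightarrow> 'v) w x. computes S \<rho> A M Y f w x)))"
proof -
  \<comment> \<open>Window and slowdown are functions of \<open>s\<close> and \<open>\<rho>\<close>,
    so they are fixed before \<open>A\<close> and hence before the numbers of cells and
    beats.\<close>
  have main: "\<exists>M Y. embedding ((2 * s + 2) * (\<rho> + 1)) (2 * s + 2) \<rho> A M Y \<and>
      (cells A = 1 \<longrightarrow> no_transfers M) \<and>
      (\<forall>(f :: 'op \<Rightarrow> 'v option \<Rightarrow> 'v list \<Rightarrow> 'v) w x. computes (2 * s + 2) \<rho> A M Y f w x)"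
    if "systolic_wf r \<rho> A" "streams A = s" for A :: "'op systolic"
  proof -
    interpret ring_embedding A r \<rho> by unfold_locales (fact that(1))
    show ?thesis using embedding no_transfers computes that(2) unfolding S_def by blast
  qed
  have "rings M = cells A" if "embedding W S \<rho> A M Y"
    for W S Y and A :: "'op systolic" and M :: "'op machine"
    using that by (simp add: embedding_def)
  with main show ?thesis
    by (intro exI[of _ "(2 * s + 2) * (\<rho> + 1)"] exI[of _ "2 * s + 2"]) (simp, metis)
qed

end
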